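(* Let $R$ be a supertropical domain, $n\ge1$, and $A\in M_n(R)$. The following are equivalent: (a) $A$ is nonsingular, i.e. $|A|\in\mathcal T$; (b) the rows of $A$ are tropically independent; (c) the columns of $A$ are tropically independent.
   Context: A supertropical semiring $(R,\mathcal G_0,\nu)$ is a commutative semiring $R$ with unit $\mathbb 1$ and zero $\mathbb 0$ (with $\mathbb 0 r=\mathbb 0$ for all $r$), a semiring ideal $\mathcal G_0=\mathcal G\cup\{\mathbb 0\}$ (the ghost ideal, where $\mathcal G=\mathcal G_0\setminus\{\mathbb 0\}$), and an idempotent map $\nu:R\to\mathcal G_0$, written $a^\nu=\nu(a)$, preserving addition and multiplication, given by $\nu(a)=a+a$ and equal to the identity on $\mathcal G_0$, such that $a+b=a^\nu$ if $a^\nu=b^\nu$, and $a+b\in\{a,b\}$ if $a^\nu\ne b^\nu$. $\mathcal G_0$ is totally ordered by $a^\nu\le b^\nu$ iff $a^\nu+b^\nu=b^\nu$. Tangible elements: $\mathcal T=R\setminus\mathcal G_0$; $\mathcal T_0=\mathcal T\cup\{\mathbb 0\}$. It is a supertropical domain if $\mathcal T$ is a multiplicative monoid (closed under multiplication, containing $\mathbb 1$) and $\nu|_{\mathcal T}:\mathcal T\to\mathcal G$ is onto. Tropical determinant: $|A|=\sum_{\pi\in S_n}a_{1,\pi(1)}\cdots a_{n,\pi(n)}$. Vectors $v_1,\dots,v_m\in R^{(n)}$ (as an indexed family) are tropically dependent if there are $\alpha_1,\dots,\alpha_m\in\mathcal T_0$, not all $\mathbb 0$, such that every component of $\sum_i\alpha_iv_i$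 lies in $\mathcal G_0$; otherwise they are tropically independent. *)

theory Defs
  imports "HOL-Analysis.Finite_Cartesian_Product" "HOL-Analysis.Cartesian_Space" "HOL-Combinatorics.Permutations"
begin

text \<open>
  The semiring \<open>R\<close> is the whole type \<open>'r\<close>. The class \<open>comm_semiring_1\<close> includes \<open>0 * r = 0\<close>;
  it also includes \<open>0 \<noteq> 1\<close>, which any supertropical domain satisfies, since \<open>1\<close> is tangible
  there and \<open>0\<close> is not.
\<close>

definition semiring_ideal :: "'r::comm_semiring_1 set \<Rightarrow> bool" where
  "semiring_ideal I \<longleftrightarrow>
     0 \<in> I \<and> (\<forall>a\<in>I. \<forall>b\<in>I. a + b \<in> I) \<and> (\<forall>r. \<forall>a\<in>I. r * a \<in> I)"

definition ghosts :: "'r::comm_semiring_1 set \<Rightarrow> 'r set" where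
  "ghosts G0 = G0 - {0}"

definition tangibles :: "'r::comm_semiring_1 set \<Rightarrow> 'r set" where
  "tangibles G0 = UNIV - G0"

definition tangibles0 :: "'r::comm_semiring_1 set \<Rightarrow> 'r set" where
  "tangibles0 G0 = tangibles G0 \<union> {0}"

locale supertropical_semiring =
  fixes G0 :: "'r::comm_semiring_1 set" and \<nu> :: "'r \<Rightarrow> 'r"
  assumes ghost_ideal: "semiring_ideal G0"
    and nu_in_ghost: "\<nu> a \<in> G0"
    and nu_idem: "\<nu> (\<nu> a) = \<nu> a"
    and nu_add: "\<nu> (a + b) = \<nu> a + \<nu> b"
    and nu_mult: "\<nu> (a * b) = \<nu> a * \<nu> b"
    and nu_eq: "\<nu> a = a + a"
    and nu_ghost: "a \<in> G0 \<Longrightarrow> \<nu> a = a"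
    and add_eq_nu: "\<nu> a = \<nu> b \<Longrightarrow> a + b = \<nu> a"
    and add_bipotent: "\<nu> a \<noteq> \<nu> b \<Longrightarrow> a + b \<in> {a, b}"
begin

definition nu_le :: "'r \<Rightarrow> 'r \<Rightarrow> bool" where
  "nu_le a b \<longleftrightarrow> \<nu> a + \<nu> b = \<nu> b"

text \<open>
  That \<open>nu_le\<close> is a total order on \<open>G0\<close> follows from the axioms, so the locale does not assume it.
\<close>

lemma nu_le_refl: "nu_le a a"
  by (metis nu_le_def nu_eq nu_idem)

lemma nu_le_trans: "nu_le a b \<Longrightarrow> nu_le b c \<Longrightarrow> nu_le a c"
  by (metis nu_le_def add.assoc)

lemma nu_le_antisym: "a \<in> G0 \<Longrightarrow> b \<in> G0 \<Longrightarrow> nu_le a b \<Longrightarrow> nu_le b a \<Longrightarrow> a = b"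
  by (metis nu_le_def add.commute nu_ghost)

lemma nu_le_total: "nu_le a b \<or> nu_le b a"
proof (cases "\<nu> a = \<nu> b")
  case True
  then show ?thesis by (metis nu_le_def nu_eq nu_idem)
next
  case False
  then have "\<nu> a + \<nu> b \<in> {\<nu> a, \<nu> b}"
    using add_bipotent[of "\<nu> a" "\<nu> b"] by (simp only: nu_idem) simp
  then show ?thesis by (auto simp: nu_le_def add.commute)
qed

end

locale supertropical_domain = supertropical_semiring +
  assumes one_tangible: "1 \<in> tangibles G0"
    and mult_tangible: "a \<in> tangibles G0 \<Longrightarrow> b \<in> tangibles G0 \<Longrightarrow> a * b \<in> tangibles G0"
    and nu_tangible_onto: "\<nu> ` tangibles G0 = ghosts G0"

definition trop_det :: "'r::comm_semiring_1 ^ 'n ^ 'n \<Rightarrow> 'r" where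
  "trop_det A = (\<Sum>\<pi> | \<pi> permutes (UNIV :: 'n set). \<Prod>i\<in>UNIV. A $ i $ \<pi> i)"

definition nonsingular :: "'r::comm_semiring_1 set \<Rightarrow> 'r ^ 'n ^ 'n \<Rightarrow> bool" where
  "nonsingular G0 A \<longleftrightarrow> trop_det A \<in> tangibles G0"

text \<open>
  Dependence is a property of the indexed family \<open>v\<close>, not of its range: two equal rows of a matrix
  count as two vectors.
\<close>

definition tropically_dependent ::
  "'r::comm_semiring_1 set \<Rightarrow> ('m::finite \<Rightarrow> 'r ^ 'n) \<Rightarrow> bool" where
  "tropically_dependent G0 v \<longleftrightarrow>
     (\<exists>\<alpha>. (\<forall>i. \<alpha> i \<in> tangibles0 G0) \<and> (\<exists>i. \<alpha> i \<noteq> 0) \<and>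
          (\<forall>j. (\<Sum>i\<in>UNIV. \<alpha> i *s v i) $ j \<in> G0))"

definition tropically_independent ::
  "'r::comm_semiring_1 set \<Rightarrow> ('m::finite \<Rightarrow> 'r ^ 'n) \<Rightarrow> bool" where
  "tropically_independent G0 v \<longleftrightarrow> \<not> tropically_dependent G0 v"

end

theory Submission
  imports Defs
begin

text \<open>
  In a supertropical semiring a finite sum has the \<open>\<nu>\<close>-value of its largest term, and it is ghost
  precisely when that maximum is attained by a ghost term or attained twice; otherwise the sum is its
  unique, tangible, largest term. The determinant is therefore tangible iff one permutation has
  strictly larger weight than all the others and meets only tangible entries
  (\<open>sum_in_G0_if_ghost_or_tied\<close>, \<open>sum_eq_strict_maximum\<close>).

  Suppose the determinant is tangible, with dominant permutation \<open>p\<close>, and a combination of the rows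
  with coefficients \<open>\<alpha>\<close> is ghost. In column \<open>p i\<close>, with \<open>\<alpha> i \<noteq> 0\<close>, the tangible term of row \<open>i\<close>
  must be matched or beaten by the term of some other row \<open>f i\<close>. Following \<open>f\<close> around its cycles gives
  a second permutation whose weight, once the coefficients along the cycles are cancelled, is at least
  that of \<open>p\<close>: a contradiction. Tangible elements can be cancelled from \<open>\<nu>\<close>-inequalities because a
  product of tangibles is never ghost (\<open>nu_le_mult_cancel_left\<close>).

  Suppose the determinant is ghost. The coefficients are the cofactors along one column \<open>c\<close>, each
  replaced by a tangible element of the same \<open>\<nu>\<close>-value. By Laplace expansion, the entry of the
  combination in another column is the determinant of a matrix with a repeated column; swapping the two
  copies shows that its maximum is attained in two different rows, and this survives the replacement
  (\<open>cofactor_combination_ghost\<close>). In column \<open>c\<close> the entry has the \<open>\<nu>\<close>-value of the determinant; if \<open>c\<close>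
  is chosen where a maximal permutation meets a ghost entry, or where two maximal permutations differ,
  this maximum is again ghost or attained twice. If the determinant is \<open>0\<close>, all these cofactors may
  vanish; then the same construction is applied to a maximal nonvanishing minor with one row adjoined.

  The statement on columns follows since the determinant is invariant under transposition.
\<close>

section \<open>The order of ghost values\<close>

context supertropical_semiring
begin

lemma zero_in_G0: "0 \<in> G0"
  using ghost_ideal by (simp add: semiring_ideal_def)

lemma mult_in_G0: "a \<in> G0 \<Longrightarrow> r * a \<in> G0"
  using ghost_ideal by (simp add: semiring_ideal_def)

lemma nu_zero: "\<nu> 0 = 0"
  by (simp add: nu_ghost zero_in_G0)

lemma nu_eq_zero_iff: "\<nu> a = 0 \<longleftrightarrow> a = 0"
  using add_eq_nu[of a 0] by (auto simp: nu_zero)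

lemma zero_nu_le: "nu_le 0 a"
  by (simp add: nu_le_def nu_zero)

lemma nu_le_zero_iff: "nu_le a 0 \<longleftrightarrow> a = 0"
  by (auto simp: nu_le_def nu_zero nu_eq_zero_iff)

lemma nu_le_cong: "\<nu> a = \<nu> a' \<Longrightarrow> \<nu> b = \<nu> b' \<Longrightarrow> nu_le a b \<longleftrightarrow> nu_le a' b'"
  by (simp add: nu_le_def)

lemma nu_le_if_nu_eq: "\<nu> a = \<nu> b \<Longrightarrow> nu_le a b"
  using nu_le_cong[of a b b b] nu_le_refl by simp

lemma nu_eq_if_nu_le: "nu_le a b \<Longrightarrow> nu_le b a \<Longrightarrow> \<nu> a = \<nu> b"
  by (metis nu_le_def add.commute)

lemma nu_le_mult_left: "nu_le a b \<Longrightarrow> nu_le (c * a) (c * b)"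
  by (simp add: nu_le_def nu_mult flip: distrib_left)

lemma nu_le_mult: "nu_le a b \<Longrightarrow> nu_le c d \<Longrightarrow> nu_le (a * c) (b * d)"
  by (metis nu_le_mult_left nu_le_trans mult.commute)

lemma nu_le_prod: "(\<And>i. i \<in> S \<Longrightarrow> nu_le (x i) (y i)) \<Longrightarrow> nu_le (prod x S) (prod y S)"
  by (induction S rule: infinite_finite_induct) (auto simp: nu_le_refl nu_le_mult)

lemma nu_le_add_left: "nu_le a (a + b)"
  by (simp add: nu_le_def nu_add nu_eq flip: add.assoc) (metis nu_eq nu_idem nu_add add.assoc)

lemma add_nu_le: "nu_le a c \<Longrightarrow> nu_le b c \<Longrightarrow> nu_le (a + b) c"
  by (simp add: nu_le_def nu_add add.assoc)

lemma nu_le_sum: "finite S \<Longrightarrow> i \<in> S \<Longrightarrow> nu_le (x i) (sum x S)"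
  by (simp add: sum.remove nu_le_add_left)

lemma sum_nu_le: "(\<And>i. i \<in> S \<Longrightarrow> nu_le (x i) b) \<Longrightarrow> nu_le (sum x S) b"
  by (induction S rule: infinite_finite_induct) (auto simp: zero_nu_le add_nu_le)

lemma ex_nu_maximal:
  assumes "finite S" "S \<noteq> {}"
  shows "\<exists>i\<in>S. \<forall>k\<in>S. nu_le (x k) (x i)"
  using assms
proof (induction S rule: finite_ne_induct)
  case (singleton i)
  then show ?case by (simp add: nu_le_refl)
next
  case (insert j S)
  then obtain i where "i \<in> S" "\<forall>k\<in>S. nu_le (x k) (x i)" by blast
  then show ?case
    using nu_le_total[of "x i" "x j"] nu_le_trans nu_le_refl by (metis insert_iff)
qed

lemma nu_sum_eq_maximal:
  assumes "finite S" "i \<in> S" "\<And>k. k \<in> S \<Longrightarrow> nu_le (x k) (x i)"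
  shows "\<nu> (sum x S) = \<nu> (x i)"
  by (meson assms nu_eq_if_nu_le nu_le_sum sum_nu_le)

text \<open>
  Split off the maximal term \<open>x i\<close>. Either the rest of the sum has the same \<open>\<nu>\<close>-value and the total is
  \<open>\<nu> (x i)\<close>, or the rest is strictly smaller, which excludes a tie, and the total is \<open>x i\<close> itself.
\<close>

lemma sum_in_G0_if_ghost_or_tied:
  assumes "finite S" "i \<in> S" and max: "\<And>k. k \<in> S \<Longrightarrow> nu_le (x k) (x i)"
    and "x i \<in> G0 \<or> (\<exists>k\<in>S. k \<noteq> i \<and> nu_le (x i) (x k))"
  shows "sum x S \<in> G0"
proof -
  define y where "y = sum x (S - {i})"
  have sum: "sum x S = x i + y"
    using assms by (simp add: y_def sum.remove)
  have y: "nu_le y (x i)"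
    unfolding y_def by (rule sum_nu_le) (use max in auto)
  show ?thesis
  proof (cases "\<nu> (x i) = \<nu> y")
    case True
    then show ?thesis by (simp add: sum add_eq_nu nu_in_ghost)
  next
    case False
    have "\<not> nu_le (x i) (x k)" if "k \<in> S" "k \<noteq> i" for k
      using that False y assms(1) nu_le_sum[of "S - {i}" k x] nu_le_trans nu_eq_if_nu_le
      unfolding y_def by (metis Diff_iff finite_Diff singletonD)
    then have "x i \<in> G0" using assms(4) by blast
    moreover have "x i + y \<noteq> y \<or> x i = y"
      using False y nu_le_add_left[of "x i" y] nu_eq_if_nu_le by metis
    ultimately show ?thesis
      using add_bipotent[OF False] sum by auto
  qed
qed

lemma sum_eq_strict_maximum:
  assumes "finite S" "i \<in> S" and "\<And>k. k \<in> S \<Longrightarrow> k \<noteq> i \<Longrightarrow> \<not> nu_le (x i) (x k)"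
  shows "sum x S = x i"
proof (cases "S - {i} = {}")
  case True
  then have "S = {i}" using assms by blast
  then show ?thesis by simp
next
  case False
  define y where "y = sum x (S - {i})"
  have sum: "sum x S = x i + y"
    using assms by (simp add: y_def sum.remove)
  obtain k where k: "k \<in> S - {i}" "\<forall>l\<in>S - {i}. nu_le (x l) (x k)"
    using ex_nu_maximal[of "S - {i}" x] False assms by blast
  then have "\<nu> y = \<nu> (x k)"
    unfolding y_def by (intro nu_sum_eq_maximal) (use assms in auto)
  then have "\<not> nu_le (x i) y"
    using assms(3)[of k] k nu_le_cong by blast
  moreover from this have "x i + y \<in> {x i, y}"
    by (intro add_bipotent) (auto dest: nu_le_if_nu_eq)
  ultimately show ?thesis
    using sum nu_le_add_left[of "x i" y] by auto
qed

end

context supertropical_domain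
begin

lemma prod_tangible:
  "(\<And>i. i \<in> S \<Longrightarrow> x i \<in> tangibles G0) \<Longrightarrow> prod x S \<in> tangibles G0"
  by (induction S rule: infinite_finite_induct) (auto simp: one_tangible mult_tangible)

text \<open>
  If \<open>\<nu> a < \<nu> b\<close> but \<open>c * a\<close> and \<open>c * b\<close> had equal \<open>\<nu>\<close>-values, then \<open>c * b = c * (a + b)\<close> would be
  a sum of two terms of equal value, hence ghost, although \<open>b\<close> and \<open>c\<close> are tangible.
\<close>

lemma nu_le_mult_cancel_left:
  assumes "c \<in> tangibles G0" "b \<in> tangibles G0" "nu_le (c * b) (c * a)"
  shows "nu_le b a"
proof (rule ccontr)
  assume not: "\<not> nu_le b a"
  then have le: "nu_le a b" using nu_le_total by blast
  have "\<nu> a \<noteq> \<nu> b" using not nu_le_if_nu_eq[of b a] by auto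
  then have "a + b \<in> {a, b}" by (rule add_bipotent)
  moreover have "nu_le b (a + b)" using nu_le_add_left[of b a] by (simp add: add.commute)
  ultimately have "a + b = b" using not by auto
  then have "c * a + c * b = c * b" by (simp flip: distrib_left)
  moreover have "\<nu> (c * a) = \<nu> (c * b)"
    using le assms(3) nu_le_mult_left nu_eq_if_nu_le by blast
  ultimately have "c * b \<in> G0" using add_eq_nu nu_in_ghost by metis
  then show False using mult_tangible[OF assms(1,2)] by (simp add: tangibles_def)
qed

text \<open>
  Surjectivity of \<open>\<nu>\<close> on tangibles lets ghost cofactors serve as coefficients
  of a dependence.
\<close>

lemma ex_tangible_lift: "\<exists>t\<in>tangibles0 G0. \<nu> t = \<nu> a"
proof (cases "a = 0")
  case True
  then show ?thesis by (auto simp: tangibles0_def)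
next
  case False
  then have "\<nu> a \<in> ghosts G0" by (simp add: ghosts_def nu_in_ghost nu_eq_zero_iff)
  then have "\<nu> a \<in> \<nu> ` tangibles G0" by (simp add: nu_tangible_onto)
  then show ?thesis by (auto simp: tangibles0_def)
qed

section \<open>Independence of the rows of a nonsingular matrix\<close>

text \<open>
  A self-map of a finite nonempty set permutes some nonempty subset, for instance one of its cycles.
  A smallest nonempty invariant subset works: its image is invariant too, so it is the whole subset.
\<close>

lemma ex_invariant_bij_subset:
  assumes "finite S" "S \<noteq> {}" "f ` S \<subseteq> S"
  shows "\<exists>C\<subseteq>S. C \<noteq> {} \<and> bij_betw f C C"
proof -
  define P where "P C \<longleftrightarrow> C \<subseteq> S \<and> C \<noteq> {} \<and> f ` C \<subseteq> C" for C
  obtain C where C: "P C" and min: "\<And>D. P D \<Longrightarrow> card C \<le> card D"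
    using ex_has_least_nat[of P S card] assms unfolding P_def by blast
  have fin: "finite C" using C assms(1) finite_subset unfolding P_def by blast
  have "P (f ` C)" using C unfolding P_def by blast
  then have "f ` C = C"
    using min[of "f ` C"] C fin by (intro card_seteq) (auto simp: P_def)
  then show ?thesis
    using fin C eq_card_imp_inj_on[of C f] by (auto simp: P_def bij_betw_def)
qed

text \<open>
  The set of rows is a parameter, and column indices need not be permuted, so that the same product
  also describes the terms of the minors.
\<close>

definition weight :: "'a ^ 'n ^ 'm \<Rightarrow> ('m \<Rightarrow> 'n) \<Rightarrow> 'm set \<Rightarrow> 'a" where
  "weight A f K = (\<Prod>i\<in>K. A $ i $ f i)"

lemma trop_det_eq_sum_weight: "trop_det A = (\<Sum>p | p permutes UNIV. weight A p UNIV)"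
  by (simp add: trop_det_def weight_def)

lemma ex_maximal_permutation:
  fixes A :: "'a ^ 'n ^ 'n"
  shows "\<exists>p. p permutes UNIV \<and> (\<forall>q. q permutes UNIV \<longrightarrow> nu_le (weight A q UNIV) (weight A p UNIV))"
proof -
  have "{p. p permutes (UNIV :: 'n set)} \<noteq> {}" using permutes_id by blast
  then show ?thesis
    using ex_nu_maximal[of "{p. p permutes (UNIV :: 'n set)}" "\<lambda>p. weight A p UNIV"]
    by (simp add: finite_permutations)
qed

lemma dependent_iff:
  "tropically_dependent G0 (\<lambda>i. row i A) \<longleftrightarrow>
    (\<exists>\<alpha>. (\<forall>i. \<alpha> i \<in> tangibles0 G0) \<and> (\<exists>i. \<alpha> i \<noteq> 0) \<and> (\<forall>j. (\<Sum>i\<in>UNIV. \<alpha> i * A $ i $ j) \<in> G0))"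
  by (simp add: tropically_dependent_def row_def)

lemma weight_tangible_iff:
  fixes A :: "'a ^ 'n ^ 'm"
  shows "weight A f K \<in> tangibles G0 \<longleftrightarrow> (\<forall>i\<in>K. A $ i $ f i \<in> tangibles G0)"
proof
  assume *: "weight A f K \<in> tangibles G0"
  show "\<forall>i\<in>K. A $ i $ f i \<in> tangibles G0"
  proof
    fix i assume "i \<in> K"
    then have "weight A f K = weight A f (K - {i}) * A $ i $ f i"
      by (simp add: weight_def prod.remove mult.commute)
    then show "A $ i $ f i \<in> tangibles G0"
      using * mult_in_G0[of "A $ i $ f i"] by (auto simp: tangibles_def)
  qed
qed (auto simp: weight_def prod_tangible)

text \<open>
  The weight of the dominant permutation is compared with that of the permutation obtained from it
  along a cycle of \<open>i \<mapsto> f i\<close>, where \<open>f i\<close> is a row that keeps row \<open>i\<close> from being the strict maximum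
  in column \<open>p i\<close> of the combination.
\<close>

lemma nonsingular_imp_rows_independent:
  fixes A :: "'a ^ 'n ^ 'n"
  assumes "nonsingular G0 A"
  shows "tropically_independent G0 (\<lambda>i. row i A)"
  unfolding tropically_independent_def
proof
  assume "tropically_dependent G0 (\<lambda>i. row i A)"
  then obtain \<alpha> where \<alpha>: "\<And>i. \<alpha> i \<in> tangibles0 G0" "\<exists>i. \<alpha> i \<noteq> 0"
      and col: "\<And>j. (\<Sum>i\<in>UNIV. \<alpha> i * A $ i $ j) \<in> G0"
    unfolding dependent_iff by blast
  have det: "trop_det A \<notin> G0" using assms by (simp add: nonsingular_def tangibles_def)
  obtain p where p: "p permutes UNIV"
      and max: "\<And>q. q permutes UNIV \<Longrightarrow> nu_le (weight A q UNIV) (weight A p UNIV)"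
    using ex_maximal_permutation by blast
  have strict: "\<not> nu_le (weight A p UNIV) (weight A q UNIV)" if "q permutes UNIV" "q \<noteq> p" for q
    using det sum_in_G0_if_ghost_or_tied[of "{p. p permutes UNIV}" p "\<lambda>p. weight A p UNIV"] p max that
    by (auto simp: trop_det_eq_sum_weight finite_permutations)
  have wp: "weight A p UNIV \<in> tangibles G0"
    using det sum_in_G0_if_ghost_or_tied[of "{p. p permutes UNIV}" p "\<lambda>p. weight A p UNIV"] p max
    by (auto simp: trop_det_eq_sum_weight finite_permutations tangibles_def)
  define S where "S = {i. \<alpha> i \<noteq> 0}"
  have tang: "\<alpha> i \<in> tangibles G0" if "i \<in> S" for i
    using that \<alpha>(1)[of i] by (auto simp: S_def tangibles0_def)
  have "\<exists>k\<in>S. k \<noteq> i \<and> nu_le (\<alpha> i * A $ i $ p i) (\<alpha> k * A $ k $ p i)" if i: "i \<in> S" for i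
  proof -
    have t: "\<alpha> i * A $ i $ p i \<in> tangibles G0"
      using i tang mult_tangible wp by (auto simp: weight_tangible_iff)
    then have "(\<Sum>k\<in>UNIV. \<alpha> k * A $ k $ p i) \<noteq> \<alpha> i * A $ i $ p i"
      using col[of "p i"] by (auto simp: tangibles_def)
    then obtain k where k: "k \<noteq> i" "nu_le (\<alpha> i * A $ i $ p i) (\<alpha> k * A $ k $ p i)"
      using sum_eq_strict_maximum[of UNIV i "\<lambda>k. \<alpha> k * A $ k $ p i"] by auto
    moreover have "k \<in> S"
      using k(2) t zero_in_G0 by (auto simp: S_def nu_le_zero_iff tangibles_def)
    ultimately show ?thesis by blast
  qed
  then obtain f where f: "\<And>i. i \<in> S \<Longrightarrow> f i \<in> S \<and> f i \<noteq> i \<and>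
      nu_le (\<alpha> i * A $ i $ p i) (\<alpha> (f i) * A $ (f i) $ p i)"
    by metis
  \<comment> \<open>\<open>f\<close> permutes \<open>C\<close> without fixed points, so its extension \<open>g\<close> by the identity is not the identity.\<close>
  obtain C where C: "C \<subseteq> S" "C \<noteq> {}" "bij_betw f C C"
    using ex_invariant_bij_subset[of S f] \<alpha>(2) f by (auto simp: S_def)
  define g where "g i = (if i \<in> C then f i else i)" for i
  have g: "g permutes UNIV"
  proof -
    have "bij_betw g C C" using C(3) by (rule bij_betw_cong[THEN iffD1, rotated]) (simp add: g_def)
    then have "g permutes C" by (rule bij_imp_permutes) (simp add: g_def)
    then show ?thesis by (rule permutes_subset) simp
  qed
  \<comment> \<open>Setting the coefficients to \<open>1\<close> off \<open>C\<close> keeps their product tangible and makes the comparison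
    below an equality there.\<close>
  define \<beta> where "\<beta> i = (if i \<in> C then \<alpha> i else 1)" for i
  define q where "q = p \<circ> inv g"
  have qg: "q (g i) = p i" for i
    using g by (simp add: q_def permutes_inverses)
  have "nu_le (\<Prod>i\<in>UNIV. \<beta> i * A $ i $ p i) (\<Prod>i\<in>UNIV. \<beta> (g i) * A $ g i $ p i)"
  proof (rule nu_le_prod)
    fix i
    show "nu_le (\<beta> i * A $ i $ p i) (\<beta> (g i) * A $ g i $ p i)"
      using f[of i] C(1) bij_betwE[OF C(3)] by (auto simp: \<beta>_def g_def nu_le_refl)
  qed
  also have "(\<Prod>i\<in>UNIV. \<beta> (g i) * A $ g i $ p i) = (\<Prod>i\<in>UNIV. \<beta> (g i) * A $ g i $ q (g i))"
    by (simp add: qg)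
  also have "\<dots> = (\<Prod>i\<in>UNIV. \<beta> i * A $ i $ q i)"
    using prod.permute[OF g, of "\<lambda>i. \<beta> i * A $ i $ q i"] by (simp add: o_def)
  finally have "nu_le (prod \<beta> UNIV * weight A p UNIV) (prod \<beta> UNIV * weight A q UNIV)"
    by (simp add: prod.distrib weight_def)
  moreover have "prod \<beta> UNIV \<in> tangibles G0"
    using C(1) tang one_tangible by (intro prod_tangible) (auto simp: \<beta>_def)
  ultimately have "nu_le (weight A p UNIV) (weight A q UNIV)"
    using wp nu_le_mult_cancel_left by blast
  moreover have "q permutes UNIV"
    unfolding q_def by (intro permutes_compose permutes_inv g p)
  moreover have "q \<noteq> p"
  proof
    assume "q = p"
    obtain i where "i \<in> C" using C(2) by blast
    then have "g i \<noteq> i" using f C(1) by (auto simp: g_def)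
    moreover have "p (g i) = p i" using qg \<open>q = p\<close> by metis
    ultimately show False using permutes_inj[OF p] by (auto dest: injD)
  qed
  ultimately show False using strict by blast
qed

section \<open>Tangible cofactors\<close>

text \<open>
  The \<open>\<nu>\<close>-value of \<open>\<beta> i\<close> is that of the minor on the rows \<open>K - {i}\<close> and the columns \<open>J\<close>, expressed
  as the maximal weight of a bijection between them. It is meant for \<open>card K = card J + 1\<close>; a minor
  without any bijection has value \<open>0\<close>.
\<close>

definition tangible_cofactors ::
  "'a ^ 'n ^ 'm \<Rightarrow> 'm set \<Rightarrow> 'n set \<Rightarrow> ('m \<Rightarrow> 'a) \<Rightarrow> bool" where
  "tangible_cofactors A K J \<beta> \<longleftrightarrow>
    (\<forall>i. \<beta> i \<in> tangibles0 G0) \<and> (\<forall>i. i \<notin> K \<longrightarrow> \<beta> i = 0) \<and>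
    (\<forall>i\<in>K. \<forall>f. bij_betw f (K - {i}) J \<longrightarrow> nu_le (weight A f (K - {i})) (\<beta> i)) \<and>
    (\<forall>i\<in>K. \<beta> i \<noteq> 0 \<longrightarrow> (\<exists>f. bij_betw f (K - {i}) J \<and> \<nu> (weight A f (K - {i})) = \<nu> (\<beta> i)))"

text \<open>
  Cofactors are obtained by applying this to the weights of all bijections of a minor.
\<close>

lemma ex_tangible_supremum:
  assumes "finite S"
  shows "\<exists>t\<in>tangibles0 G0. (\<forall>k\<in>S. nu_le (x k) t) \<and> (t \<noteq> 0 \<longrightarrow> (\<exists>k\<in>S. \<nu> (x k) = \<nu> t))"
proof (cases "S = {}")
  case True
  then show ?thesis by (auto simp: tangibles0_def)
next
  case False
  then obtain k where k: "k \<in> S" "\<forall>l\<in>S. nu_le (x l) (x k)"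
    using ex_nu_maximal assms by blast
  obtain t where "t \<in> tangibles0 G0" "\<nu> t = \<nu> (x k)" using ex_tangible_lift by blast
  then show ?thesis using k nu_le_cong by metis
qed

lemma ex_tangible_cofactors:
  fixes A :: "'a ^ 'n ^ 'm"
  shows "\<exists>\<beta>. tangible_cofactors A K J \<beta>"
proof -
  have "\<exists>t\<in>tangibles0 G0.
      (\<forall>f\<in>{f. bij_betw f (K - {i}) J}. nu_le (weight A f (K - {i})) t) \<and>
      (t \<noteq> 0 \<longrightarrow> (\<exists>f\<in>{f. bij_betw f (K - {i}) J}. \<nu> (weight A f (K - {i})) = \<nu> t))" for i
    by (rule ex_tangible_supremum) simp
  then obtain b where b: "\<And>i. b i \<in> tangibles0 G0 \<and>
      (\<forall>f\<in>{f. bij_betw f (K - {i}) J}. nu_le (weight A f (K - {i})) (b i)) \<and>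
      (b i \<noteq> 0 \<longrightarrow> (\<exists>f\<in>{f. bij_betw f (K - {i}) J}. \<nu> (weight A f (K - {i})) = \<nu> (b i)))"
    by metis
  have "tangible_cofactors A K J (\<lambda>i. if i \<in> K then b i else 0)"
    using b by (auto simp: tangible_cofactors_def tangibles0_def)
  then show ?thesis by blast
qed

lemma bij_betw_remove:
  assumes "bij_betw g K (insert j J)" "j \<notin> J" "i \<in> K" "g i = j"
  shows "bij_betw g (K - {i}) J"
  using assms bij_betw_DiffI[OF assms(1), of "{i}" "{j}"] by (simp add: bij_betw_def)

lemma bij_betw_extend:
  assumes "bij_betw f (K - {i}) J" "i \<in> K" "j \<notin> J"
  shows "bij_betw (f(i := j)) K (insert j J)"
proof -
  have "bij_betw (f(i := j)) (K - {i}) J"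
    using assms(1) by (rule bij_betw_cong[THEN iffD1, rotated]) auto
  then have "bij_betw (f(i := j)) (insert i (K - {i})) (insert j J)"
    using notIn_Un_bij_betw[of i "K - {i}" "f(i := j)" J] assms(3) by simp
  then show ?thesis using assms(2) by (simp add: insert_absorb)
qed

lemma weight_remove:
  fixes A :: "'a ^ 'n ^ 'm"
  assumes "i \<in> K"
  shows "weight A f K = weight A f (K - {i}) * A $ i $ f i"
  using assms by (simp add: weight_def prod.remove mult.commute)

lemma weight_extend:
  fixes A :: "'a ^ 'n ^ 'm"
  assumes "i \<in> K"
  shows "weight A (f(i := j)) K = weight A f (K - {i}) * A $ i $ j"
  using weight_remove[OF assms, of A "f(i := j)"] by (simp add: weight_def)

text \<open>
  This lemma and the next one are Laplace expansion along column \<open>j\<close> at the level of \<open>\<nu>\<close>-values: the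
  products \<open>\<beta> i * A $ i $ j\<close> bound, and if \<open>\<beta> i\<close> is nonzero are attained by, the weights of bijections
  onto \<open>insert j J\<close>.
\<close>

lemma weight_nu_le_cofactor_mult:
  fixes A :: "'a ^ 'n ^ 'm"
  assumes "tangible_cofactors A K J \<beta>" "bij_betw g K (insert j J)" "j \<notin> J" "i \<in> K" "g i = j"
  shows "nu_le (weight A g K) (\<beta> i * A $ i $ j)"
  using assms(1,4) bij_betw_remove[OF assms(2-5)] weight_remove[OF assms(4), of A g] assms(5)
  by (auto simp: tangible_cofactors_def nu_le_mult nu_le_refl)

lemma cofactor_mult_attained:
  fixes A :: "'a ^ 'n ^ 'm"
  assumes "tangible_cofactors A K J \<beta>" "j \<notin> J" "i \<in> K" "\<beta> i \<noteq> 0"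
  shows "\<exists>g. bij_betw g K (insert j J) \<and> \<nu> (weight A g K) = \<nu> (\<beta> i * A $ i $ j)"
proof -
  obtain f where f: "bij_betw f (K - {i}) J" "\<nu> (weight A f (K - {i})) = \<nu> (\<beta> i)"
    using assms unfolding tangible_cofactors_def by blast
  have "\<nu> (weight A (f(i := j)) K) = \<nu> (\<beta> i * A $ i $ j)"
    using f(2) by (simp add: weight_extend[OF assms(3)] nu_mult)
  then show ?thesis using bij_betw_extend[OF f(1) assms(3,2)] by blast
qed

text \<open>
  Laplace expansion with column \<open>j\<close> repeated. Suppose the maximal term comes from row \<open>i\<close> and a
  bijection \<open>f\<close> on the other rows, and let \<open>k\<close> be the row that \<open>f\<close> sends to \<open>j\<close>. Exchanging the two
  copies of column \<open>j\<close> between \<open>i\<close> and \<open>k\<close> leaves the product unchanged but turns it into a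
  contribution to the term of row \<open>k\<close>. So the maximum is attained twice, whether or not the original
  cofactors were tangible.
\<close>

lemma cofactor_combination_ghost:
  fixes A :: "'a ^ 'n ^ 'm"
  assumes \<beta>: "tangible_cofactors A K J \<beta>" and "j \<in> J"
  shows "(\<Sum>i\<in>UNIV. \<beta> i * A $ i $ j) \<in> G0"
proof -
  obtain i where max: "\<And>k. nu_le (\<beta> k * A $ k $ j) (\<beta> i * A $ i $ j)"
    using ex_nu_maximal[of UNIV "\<lambda>i. \<beta> i * A $ i $ j"] by auto
  have "\<beta> i * A $ i $ j \<in> G0 \<or>
      (\<exists>k\<in>UNIV. k \<noteq> i \<and> nu_le (\<beta> i * A $ i $ j) (\<beta> k * A $ k $ j))"
  proof (cases "\<beta> i = 0")
    case True
    then show ?thesis by (simp add: zero_in_G0)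
  next
    case False
    then have i: "i \<in> K" using \<beta> by (auto simp: tangible_cofactors_def)
    then obtain f where f: "bij_betw f (K - {i}) J" "\<nu> (weight A f (K - {i})) = \<nu> (\<beta> i)"
      using \<beta> False unfolding tangible_cofactors_def by blast
    obtain k where k: "k \<in> K - {i}" "f k = j"
      using f(1) assms(2) by (auto simp: bij_betw_def)
    have J: "J = insert j (J - {j})" using assms(2) by blast
    have "bij_betw f (K - {i} - {k}) (J - {j})"
      using bij_betw_remove[of f "K - {i}" j "J - {j}" k] f(1) k J by auto
    then have "bij_betw (f(i := j)) (K - {k}) J"
      using bij_betw_extend[of f "K - {k}" i "J - {j}" j] i k J
      by (metis Diff_iff Diff_insert2 insert_commute singletonD singletonI)
    then have "nu_le (weight A (f(i := j)) (K - {k})) (\<beta> k)"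
      using \<beta> k by (auto simp: tangible_cofactors_def)
    then have "nu_le (weight A (f(i := j)) (K - {k}) * A $ k $ j) (\<beta> k * A $ k $ j)"
      by (simp add: nu_le_mult nu_le_refl)
    moreover have "weight A (f(i := j)) (K - {k}) * A $ k $ j
        = weight A f (K - {i}) * A $ i $ j"
    proof -
      have "weight A (f(i := j)) (K - {k}) = weight A f (K - {k} - {i}) * A $ i $ j"
        by (rule weight_extend) (use i k in auto)
      moreover have "weight A f (K - {i}) = weight A f (K - {i} - {k}) * A $ k $ j"
        using weight_remove[of k "K - {i}" A f] k by simp
      moreover have "K - {k} - {i} = K - {i} - {k}" by blast
      ultimately show ?thesis by (simp add: mult_ac)
    qed
    ultimately have "nu_le (\<beta> i * A $ i $ j) (\<beta> k * A $ k $ j)"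
      using f(2) by (simp add: nu_le_def nu_mult)
    then show ?thesis using k by blast
  qed
  then show ?thesis
    using max by (intro sum_in_G0_if_ghost_or_tied[of UNIV i]) auto
qed

section \<open>Dependence of the rows of a singular matrix\<close>

text \<open>
  Take a largest set \<open>I\<close> of rows carrying a nonzero weight, with columns \<open>J\<close>, and adjoin a row \<open>k\<close>.
  The cofactor of \<open>k\<close> is nonzero. The columns in \<open>J\<close> of the combination are ghost by the repeated-column
  argument, and the remaining ones vanish because a
  nonzero entry would extend to a nonzero weight on all of the rows \<open>insert k I\<close>.
\<close>

lemma rows_dependent_if_weights_zero:
  fixes A :: "'a ^ 'n ^ 'm"
  assumes zero: "\<And>g J. bij_betw g UNIV J \<Longrightarrow> weight A g UNIV = 0"
  shows "tropically_dependent G0 (\<lambda>i. row i A)"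
proof -
  define P where "P K \<longleftrightarrow> (\<exists>f. inj_on f K \<and> weight A f K \<noteq> 0)" for K :: "'m set"
  have "P {}" by (simp add: P_def weight_def)
  then obtain I where I: "P I" and max: "\<And>K. P K \<Longrightarrow> card K \<le> card I"
    using ex_has_greatest_nat[of P "{}" card "CARD('m) + 1"]
    by (metis card_mono finite_code le_imp_less_Suc Suc_eq_plus1 subset_UNIV)
  obtain f where f: "inj_on f I" "weight A f I \<noteq> 0" using I by (auto simp: P_def)
  have "I \<noteq> UNIV" using f zero[of f "f ` UNIV"] by (auto simp: bij_betw_def)
  then obtain k where k: "k \<notin> I" by blast
  define K where "K = insert k I"
  define J where "J = f ` I"
  have KI: "K - {k} = I" using k by (auto simp: K_def)
  have bf: "bij_betw f (K - {k}) J" using f(1) by (simp add: KI J_def bij_betw_def)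
  obtain \<beta> where \<beta>: "tangible_cofactors A K J \<beta>" using ex_tangible_cofactors by blast
  have "nu_le (weight A f I) (\<beta> k)"
    using \<beta> bf KI unfolding tangible_cofactors_def K_def by (metis insertI1)
  then have "\<beta> k \<noteq> 0" using f(2) by (auto simp: nu_le_zero_iff)
  moreover have "(\<Sum>i\<in>UNIV. \<beta> i * A $ i $ j) \<in> G0" for j
  proof (cases "j \<in> J")
    case True
    then show ?thesis using cofactor_combination_ghost[OF \<beta>] by blast
  next
    case False
    have "\<beta> i * A $ i $ j = 0" for i
    proof (rule ccontr)
      assume *: "\<beta> i * A $ i $ j \<noteq> 0"
      then have "\<beta> i \<noteq> 0" by auto
      moreover from this have "i \<in> K" using \<beta> by (auto simp: tangible_cofactors_def)
      ultimately obtain g where g: "bij_betw g K (insert j J)"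
          "\<nu> (weight A g K) = \<nu> (\<beta> i * A $ i $ j)"
        using cofactor_mult_attained[OF \<beta> False] by blast
      then have "weight A g K \<noteq> 0" using * nu_eq_zero_iff by metis
      then have "P K" using g(1) by (auto simp: P_def bij_betw_def)
      then show False using max[of K] k by (simp add: K_def)
    qed
    then show ?thesis by (simp add: zero_in_G0)
  qed
  ultimately show ?thesis
    using \<beta> unfolding dependent_iff tangible_cofactors_def by blast
qed

text \<open>
  When the maximal weight is nonzero, the column \<open>c\<close> is chosen so that the reason for which the
  determinant is ghost is visible in the expansion along \<open>c\<close>.
\<close>

lemma singular_imp_rows_dependent:
  fixes A :: "'a ^ 'n ^ 'n"
  assumes "\<not> nonsingular G0 A"
  shows "tropically_dependent G0 (\<lambda>i. row i A)"
proof -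
  have det: "trop_det A \<in> G0" using assms by (simp add: nonsingular_def tangibles_def)
  obtain p where p: "p permutes UNIV"
      and max: "\<And>q. q permutes UNIV \<Longrightarrow> nu_le (weight A q UNIV) (weight A p UNIV)"
    using ex_maximal_permutation by blast
  have perm: "q permutes UNIV \<longleftrightarrow> bij_betw q UNIV UNIV" for q :: "'n \<Rightarrow> 'n"
    by (auto intro: bij_imp_permutes permutes_imp_bij)
  show ?thesis
  proof (cases "weight A p UNIV = 0")
    case True
    have "weight A g UNIV = 0" if "bij_betw g UNIV J" for g J
    proof -
      have "g permutes UNIV"
        using that finite_UNIV_inj_surj[of g] by (auto simp: perm bij_betw_def)
      then show ?thesis using max True by (auto simp: nu_le_zero_iff)
    qed
    then show ?thesis by (rule rows_dependent_if_weights_zero)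
  next
    case False
    have "weight A p UNIV \<in> G0 \<or>
        (\<exists>q. q permutes UNIV \<and> q \<noteq> p \<and> nu_le (weight A p UNIV) (weight A q UNIV))"
    proof (rule ccontr)
      assume *: "\<not> ?thesis"
      then have "trop_det A = weight A p UNIV"
        unfolding trop_det_eq_sum_weight
        by (intro sum_eq_strict_maximum) (use p in \<open>auto simp: finite_permutations\<close>)
      then show False using * det by simp
    qed
    then obtain i where i: "A $ i $ p i \<in> G0 \<or>
        (\<exists>q. q permutes UNIV \<and> q i \<noteq> p i \<and> nu_le (weight A p UNIV) (weight A q UNIV))"
    proof
      assume "weight A p UNIV \<in> G0"
      then show thesis
        using that weight_tangible_iff[of A p UNIV] by (auto simp: tangibles_def)
    next
      assume "\<exists>q. q permutes UNIV \<and> q \<noteq> p \<and> nu_le (weight A p UNIV) (weight A q UNIV)"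
      then show thesis using that by (meson ext)
    qed
    define c where "c = p i"
    obtain \<beta> where \<beta>: "tangible_cofactors A UNIV (UNIV - {c}) \<beta>"
      using ex_tangible_cofactors by blast
    have lower: "nu_le (weight A q UNIV) (\<beta> k * A $ k $ c)"
      if "q permutes UNIV" "q k = c" for q k
      using weight_nu_le_cofactor_mult[OF \<beta>, of q c k] that by (simp add: perm insert_absorb)
    have pc: "nu_le (weight A p UNIV) (\<beta> i * A $ i $ c)"
      using lower p by (simp add: c_def)
    have upper: "nu_le (\<beta> k * A $ k $ c) (weight A p UNIV)" for k
    proof (cases "\<beta> k = 0")
      case True
      then show ?thesis by (simp add: zero_nu_le)
    next
      case False
      then obtain g where "bij_betw g UNIV (insert c (UNIV - {c}))"
          "\<nu> (weight A g UNIV) = \<nu> (\<beta> k * A $ k $ c)"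
        using cofactor_mult_attained[OF \<beta>, of c k] by auto
      moreover have "insert c (UNIV - {c}) = UNIV" by blast
      ultimately show ?thesis using max perm nu_le_cong by metis
    qed
    have "(\<Sum>k\<in>UNIV. \<beta> k * A $ k $ j) \<in> G0" for j
    proof (cases "j = c")
      case False
      then show ?thesis using cofactor_combination_ghost[OF \<beta>] by simp
    next
      case True
      have "\<beta> i * A $ i $ c \<in> G0 \<or>
          (\<exists>k\<in>UNIV. k \<noteq> i \<and> nu_le (\<beta> i * A $ i $ c) (\<beta> k * A $ k $ c))"
        using i
      proof
        assume "A $ i $ p i \<in> G0"
        then show ?thesis by (simp add: c_def mult_in_G0)
      next
        assume "\<exists>q. q permutes UNIV \<and> q i \<noteq> p i \<and> nu_le (weight A p UNIV) (weight A q UNIV)"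
        then obtain q where q: "q permutes UNIV" "q i \<noteq> p i"
            "nu_le (weight A p UNIV) (weight A q UNIV)"
          by blast
        obtain k where "q k = c" using permutes_surj[OF q(1)] by (metis surjD)
        moreover from this have "k \<noteq> i" using q(2) by (auto simp: c_def)
        ultimately show ?thesis using lower[OF q(1)] q(3) upper nu_le_trans by blast
      qed
      moreover have "nu_le (\<beta> k * A $ k $ c) (\<beta> i * A $ i $ c)" for k
        using upper pc nu_le_trans by blast
      ultimately show ?thesis
        unfolding True by (intro sum_in_G0_if_ghost_or_tied[of UNIV i]) auto
    qed
    moreover have "\<beta> i \<noteq> 0" using pc False by (auto simp: nu_le_zero_iff)
    ultimately show ?thesis
      using \<beta> unfolding dependent_iff tangible_cofactors_def by blast
  qed
qed

end

lemma trop_det_transpose: "trop_det (transpose A) = trop_det A"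
  for A :: "'r::comm_semiring_1 ^ 'n ^ 'n"
proof -
  have "(\<Prod>i\<in>UNIV. A $ p i $ i) = (\<Prod>i\<in>UNIV. A $ i $ inv p i)"
    if "p permutes UNIV" for p :: "'n \<Rightarrow> 'n"
    using prod.permute[OF that, of "\<lambda>i. A $ i $ inv p i"] that
    by (simp add: o_def permutes_inverses)
  then have "trop_det (transpose A) = (\<Sum>p | p permutes UNIV. \<Prod>i\<in>UNIV. A $ i $ inv p i)"
    by (simp add: trop_det_def transpose_def)
  also have "\<dots> = trop_det A"
    unfolding trop_det_def
    using sum_permutations_inverse[of "\<lambda>p. \<Prod>i\<in>UNIV. A $ i $ p i" UNIV] by simp
  finally show ?thesis .
qed

theorem corollary6p6:
  fixes G0 :: "'r::comm_semiring_1 set" and \<nu> :: "'r \<Rightarrow> 'r"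
    and A :: "'r ^ 'n ^ 'n"
  assumes "supertropical_domain G0 \<nu>"
  shows "(nonsingular G0 A \<longleftrightarrow> tropically_independent G0 (\<lambda>i. row i A)) \<and>
         (tropically_independent G0 (\<lambda>i. row i A) \<longleftrightarrow> tropically_independent G0 (\<lambda>j. column j A))"
proof -
  interpret supertropical_domain G0 \<nu> by (fact assms)
  have rows: "nonsingular G0 B \<longleftrightarrow> tropically_independent G0 (\<lambda>i. row i B)" for B :: "'r ^ 'n ^ 'n"
    using nonsingular_imp_rows_independent singular_imp_rows_dependent
    unfolding tropically_independent_def by blast
  have "nonsingular G0 (transpose A) \<longleftrightarrow> nonsingular G0 A"
    by (simp add: nonsingular_def trop_det_transpose)
  then show ?thesis
    using rows[of A] rows[of "transpose A"] by simp
qed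

end
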